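(* Let $\alpha,\beta,\gamma\in\mathbb{R}$, $n\in\mathbb{N}$, $n\geq 2$, and $f\in C_0^\infty(\mathbb{R}^n\backslash\{0\})$. Then $$\begin{aligned}\int_{\mathbb{R}^n}|x|^\gamma |(\Delta f)(x)|^2\, d^nx&\geq [\alpha(\gamma+n-4)-2\beta]\int_{\mathbb{R}^n}|x|^{\gamma-2}|(\nabla f)(x)|^2\, d^nx \\ &\quad-\alpha(\alpha-4+2\gamma)\int_{\mathbb{R}^n}|x|^{\gamma-4}|x\cdot(\nabla f)(x)|^2\, d^nx\\ &\quad+\beta[(n-4)(\alpha-2)-\beta+\gamma(n+\alpha+\gamma-6)]\int_{\mathbb{R}^n}|x|^{\gamma-4}|f(x)|^2\, d^nx.\end{aligned}$$ In addition, if $\alpha(\alpha-4+2\gamma)\geq 0$, then $$\begin{aligned}\int_{\mathbb{R}^n}|x|^\gamma|(\Delta f)(x)|^2\, d^nx & \geq [\alpha(n-\alpha-\gamma)-2\beta]\int_{\mathbb{R}^n}|x|^{\gamma-2}|(\nabla f)(x)|^2\, d^nx\\ &\quad+\beta[(n-4)(\alpha-2)-\beta+\gamma(n+\alpha+\gamma-6)]\int_{\mathbb{R}^n}|x|^{\gamma-4}|f(x)|^2\, d^nx.\end{aligned}$$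
   Context: $C_0^\infty(\mathbb{R}^n\backslash\{0\})$ denotes the complex-valued infinitely differentiable functions with compact support contained in $\mathbb{R}^n\backslash\{0\}$. *)

theory Defs
  imports "HOL-Analysis.Analysis"
begin

definition partial_deriv ::
    "'n::finite \<Rightarrow> (real ^ 'n \<Rightarrow> 'b::real_normed_vector) \<Rightarrow> real ^ 'n \<Rightarrow> 'b" where
  "partial_deriv i f x = vector_derivative (\<lambda>t. f (x + t *\<^sub>R axis i 1)) (at 0)"

text \<open>
  The class \<open>C\<^sup>k\<close> on the whole space. The partial derivatives are the components of the
  total derivative with respect to the standard basis, so the second clause says that \<open>f\<close> is
  differentiable and that its derivative is of class \<open>C\<^sup>k\<close>.
\<close>

primrec C_k :: "nat \<Rightarrow> (real ^ 'n::finite \<Rightarrow> 'b::real_normed_vector) \<Rightarrow> bool" where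
  "C_k 0 f \<longleftrightarrow> continuous_on UNIV f"
| "C_k (Suc k) f \<longleftrightarrow> f differentiable_on UNIV \<and> (\<forall>i. C_k k (partial_deriv i f))"

definition C_infinity :: "(real ^ 'n::finite \<Rightarrow> 'b::real_normed_vector) \<Rightarrow> bool" where
  "C_infinity f \<longleftrightarrow> (\<forall>k. C_k k f)"

definition supp :: "('a::topological_space \<Rightarrow> 'b::zero) \<Rightarrow> 'a set" where
  "supp f = closure {x. f x \<noteq> 0}"

text \<open>
  \<open>C\<^sub>0\<^sup>\<infinity>(\<Omega>)\<close> for open \<open>\<Omega>\<close>. A smooth function on \<open>\<Omega>\<close> whose support is a compact subset of \<open>\<Omega>\<close>
  is identified with its extension by zero, which is smooth on the whole space.
\<close>

definition C0_infinity :: "(real ^ 'n::finite) set \<Rightarrow> (real ^ 'n \<Rightarrow> complex) set" where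
  "C0_infinity \<Omega> = {f. C_infinity f \<and> compact (supp f) \<and> supp f \<subseteq> \<Omega>}"

text \<open>The library norm on \<^typ>\<open>complex ^ 'n\<close> is the Hermitian norm
  \<open>(\<Sum>i. |v\<^sub>i|\<^sup>2)\<^sup>1\<^sup>/\<^sup>2\<close>, so \<open>norm (grad f x)\<close> is the usual \<open>|(\<nabla>f)(x)|\<close>.\<close>

definition grad :: "(real ^ 'n::finite \<Rightarrow> complex) \<Rightarrow> real ^ 'n \<Rightarrow> complex ^ 'n" where
  "grad f x = (\<chi> i. partial_deriv i f x)"

definition laplacian :: "(real ^ 'n::finite \<Rightarrow> complex) \<Rightarrow> real ^ 'n \<Rightarrow> complex" where
  "laplacian f x = (\<Sum>i\<in>UNIV. partial_deriv i (partial_deriv i f) x)"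

text \<open>The product \<open>x \<cdot> v = \<Sum>i. x\<^sub>i v\<^sub>i\<close> of a real and a complex vector; the library's \<open>\<bullet>\<close> needs
  both arguments of the same type and is real-valued.\<close>

definition real_cdot :: "real ^ 'n::finite \<Rightarrow> complex ^ 'n \<Rightarrow> complex" where
  "real_cdot x v = (\<Sum>i\<in>UNIV. complex_of_real (x $ i) * v $ i)"

end

theory Submission
  imports Defs
begin

text \<open>
  Expand \<open>0 \<le> \<integral> |x|\<^sup>\<gamma> |-\<Delta>f + \<alpha> |x|\<^sup>-\<^sup>2 x\<cdot>\<nabla>f + \<beta> |x|\<^sup>-\<^sup>2 f|\<^sup>2\<close>, with \<open>\<complex>\<close> regarded as a real
  inner product space so that only real parts of the cross terms occur. The three cross terms are
  rewritten by integrating the divergences of \<open>|x|\<^sup>c x |f|\<^sup>2\<close>, \<open>|x|\<^sup>c Re (f\<^sup>* \<nabla>f)\<close> and of the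
  Rellich--Pohozaev field. The second inequality follows from the first by
  \<open>|x\<cdot>\<nabla>f| \<le> |x| |\<nabla>f|\<close>. That \<open>\<integral> \<partial>\<^sub>i g = 0\<close> for a \<open>C\<^sup>1\<close> function \<open>g\<close> of compact support is obtained from
  the translation invariance of Lebesgue measure: the difference quotients of \<open>g\<close> have integral
  zero and converge dominatedly to \<open>\<partial>\<^sub>i g\<close>.
\<close>

section \<open>Derivatives along lines and the symmetry of mixed second derivatives\<close>

abbreviation has_line_derivative ::
    "('a::real_normed_vector \<Rightarrow> 'b::real_normed_vector) \<Rightarrow> 'b \<Rightarrow> 'a \<Rightarrow> 'a \<Rightarrow> bool" where
  "has_line_derivative F D x a \<equiv> ((\<lambda>t. F (x + t *\<^sub>R a)) has_vector_derivative D) (at 0)"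

lemma has_line_derivative_at:
  assumes "has_line_derivative F D (x + t *\<^sub>R a) a"
  shows "((\<lambda>s. F (x + s *\<^sub>R a)) has_vector_derivative D) (at t)"
proof -
  have "((\<lambda>s. s - t) has_vector_derivative 1) (at t)"
    by (auto intro!: derivative_eq_intros)
  moreover have "((\<lambda>u. F (x + t *\<^sub>R a + u *\<^sub>R a)) has_vector_derivative D) (at (t - t))"
    using assms by simp
  ultimately have "((\<lambda>u. F (x + t *\<^sub>R a + u *\<^sub>R a)) \<circ> (\<lambda>s. s - t) has_vector_derivative 1 *\<^sub>R D) (at t)"
    by (rule vector_diff_chain_at)
  moreover have "(\<lambda>u. F (x + t *\<^sub>R a + u *\<^sub>R a)) \<circ> (\<lambda>s. s - t) = (\<lambda>s. F (x + s *\<^sub>R a))"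
    by (simp add: o_def scaleR_left_diff_distrib)
  ultimately show ?thesis by simp
qed

lemma line_mean_value:
  fixes F :: "'a::real_normed_vector \<Rightarrow> real"
  assumes D: "\<And>x. has_line_derivative F (D x) x a" and "h > 0"
  obtains s where "0 < s" "s < h" "F (x + h *\<^sub>R a) - F x = h * D (x + s *\<^sub>R a)"
proof -
  have der: "((\<lambda>s. F (x + s *\<^sub>R a)) has_real_derivative D (x + t *\<^sub>R a)) (at t)" for t
    unfolding has_real_derivative_iff_has_vector_derivative
    by (rule has_line_derivative_at[OF D])
  from MVT2[OF \<open>h > 0\<close> der] obtain z where
    "0 < z" "z < h" "F (x + h *\<^sub>R a) - F (x + 0 *\<^sub>R a) = (h - 0) * D (x + z *\<^sub>R a)"
    by blast
  then show ?thesis by (intro that[of z]) auto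
qed

text \<open>The mean value theorem is applied twice: along \<open>a\<close> to the increment
  \<open>F (y + h *\<^sub>R b) - F y\<close>, whose derivative is an increment of \<open>P\<close>,
  and then along \<open>b\<close> to \<open>P\<close> itself.\<close>

lemma second_difference_mean_value:
  fixes F :: "'a::real_normed_vector \<Rightarrow> real"
  assumes P: "\<And>x. has_line_derivative F (P x) x a"
    and R: "\<And>x. has_line_derivative P (R x) x b" and "h > 0"
  obtains s t where "0 < s" "s < h" "0 < t" "t < h"
    "F (x + h *\<^sub>R a + h *\<^sub>R b) - F (x + h *\<^sub>R a) - F (x + h *\<^sub>R b) + F x
       = h\<^sup>2 * R (x + s *\<^sub>R a + t *\<^sub>R b)"
proof -
  have "has_line_derivative (\<lambda>y. F (y + h *\<^sub>R b) - F y) (P (y + h *\<^sub>R b) - P y) y a" for y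
    using P[of "y + h *\<^sub>R b"] P[of y]
    by (intro has_vector_derivative_diff) (auto simp: algebra_simps)
  from line_mean_value[OF this \<open>h > 0\<close>] obtain s where s: "0 < s" "s < h"
    "F (x + h *\<^sub>R a + h *\<^sub>R b) - F (x + h *\<^sub>R a) - (F (x + h *\<^sub>R b) - F x)
       = h * (P (x + s *\<^sub>R a + h *\<^sub>R b) - P (x + s *\<^sub>R a))"
    by metis
  from line_mean_value[OF R \<open>h > 0\<close>] obtain t where t: "0 < t" "t < h"
    "P (x + s *\<^sub>R a + h *\<^sub>R b) - P (x + s *\<^sub>R a) = h * R (x + s *\<^sub>R a + t *\<^sub>R b)"
    by metis
  from s t show ?thesis by (intro that[of s t]) (auto simp: power2_eq_square)
qed

text \<open>The intermediate parameters lie between 0 and \<open>h\<close>, so the point where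
  \<open>R\<close> is evaluated tends to \<open>x\<close>, and continuity of \<open>R\<close>
  finishes the argument. A one-sided limit suffices to identify the value.\<close>

lemma second_difference_tendsto:
  fixes F :: "'a::real_normed_vector \<Rightarrow> real"
  assumes P: "\<And>x. has_line_derivative F (P x) x a"
    and R: "\<And>x. has_line_derivative P (R x) x b" and R_cont: "continuous_on UNIV R"
  shows "((\<lambda>h. (F (x + h *\<^sub>R a + h *\<^sub>R b) - F (x + h *\<^sub>R a) - F (x + h *\<^sub>R b) + F x) / h\<^sup>2)
           \<longlongrightarrow> R x) (at_right 0)"
proof -
  define \<Delta> where "\<Delta> h = F (x + h *\<^sub>R a + h *\<^sub>R b) - F (x + h *\<^sub>R a) - F (x + h *\<^sub>R b) + F x" for h
  have "\<exists>s t. 0 < s \<and> s < h \<and> 0 < t \<and> t < h \<and> \<Delta> h = h\<^sup>2 * R (x + s *\<^sub>R a + t *\<^sub>R b)"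
    if "h > 0" for h
    using second_difference_mean_value[OF P R that, of x] unfolding \<Delta>_def by blast
  then obtain s t where st: "\<And>h. h > 0 \<Longrightarrow> 0 < s h \<and> s h < h \<and> 0 < t h \<and> t h < h \<and>
      \<Delta> h = h\<^sup>2 * R (x + s h *\<^sub>R a + t h *\<^sub>R b)"
    by metis
  have ev: "\<forall>\<^sub>F h::real in at_right 0. h > 0"
    by (simp add: eventually_at_right_less)
  have id: "((\<lambda>h::real. h) \<longlongrightarrow> 0) (at_right 0)"
    by (rule tendsto_ident_at)
  have s0: "(s \<longlongrightarrow> 0) (at_right 0)"
  proof (rule tendsto_sandwich[OF _ _ tendsto_const id])
    show "\<forall>\<^sub>F h in at_right 0. 0 \<le> s h" "\<forall>\<^sub>F h in at_right 0. s h \<le> h"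
      using ev by (eventually_elim, meson st less_imp_le)+
  qed
  have t0: "(t \<longlongrightarrow> 0) (at_right 0)"
  proof (rule tendsto_sandwich[OF _ _ tendsto_const id])
    show "\<forall>\<^sub>F h in at_right 0. 0 \<le> t h" "\<forall>\<^sub>F h in at_right 0. t h \<le> h"
      using ev by (eventually_elim, meson st less_imp_le)+
  qed
  have "((\<lambda>h. x + s h *\<^sub>R a + t h *\<^sub>R b) \<longlongrightarrow> x) (at_right 0)"
    by (rule tendsto_eq_intros refl s0 t0)+ simp
  then have "((\<lambda>h. R (x + s h *\<^sub>R a + t h *\<^sub>R b)) \<longlongrightarrow> R x) (at_right 0)"
    using R_cont by (auto intro: continuous_on_tendsto_compose)
  moreover have "\<forall>\<^sub>F h in at_right 0. R (x + s h *\<^sub>R a + t h *\<^sub>R b) = \<Delta> h / h\<^sup>2"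
    using ev
  proof eventually_elim
    case (elim h)
    with st[of h] show ?case by (simp only:) simp
  qed
  ultimately show ?thesis
    unfolding \<Delta>_def[symmetric] by (rule Lim_transform_eventually)
qed

text \<open>Schwarz's theorem: the second difference is symmetric in \<open>a\<close> and
  \<open>b\<close>, so both mixed derivatives are limits of the same quotient. The mean value
  theorem is a statement about real functions, hence the pairing with an arbitrary vector
  \<open>c\<close>.\<close>

lemma line_derivatives_commute:
  fixes F :: "'a::real_normed_vector \<Rightarrow> 'b::real_inner"
  assumes P: "\<And>x. has_line_derivative F (P x) x a" and PQ: "\<And>x. has_line_derivative P (PQ x) x b"
    and Q: "\<And>x. has_line_derivative F (Q x) x b" and QP: "\<And>x. has_line_derivative Q (QP x) x a"
    and "continuous_on UNIV PQ" "continuous_on UNIV QP"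
  shows "PQ x = QP x"
proof -
  have "PQ x \<bullet> c = QP x \<bullet> c" for c
  proof -
    note inner = bounded_linear.has_vector_derivative[OF bounded_linear_inner_left]
    have 1: "((\<lambda>h. (F (x + h *\<^sub>R a + h *\<^sub>R b) \<bullet> c - F (x + h *\<^sub>R a) \<bullet> c - F (x + h *\<^sub>R b) \<bullet> c + F x \<bullet> c) / h\<^sup>2)
        \<longlongrightarrow> PQ x \<bullet> c) (at_right 0)"
      by (rule second_difference_tendsto[where P = "\<lambda>x. P x \<bullet> c" and R = "\<lambda>x. PQ x \<bullet> c"])
        (intro inner P PQ continuous_intros assms)+
    have swap: "F (x + h *\<^sub>R b + h *\<^sub>R a) \<bullet> c - F (x + h *\<^sub>R b) \<bullet> c - F (x + h *\<^sub>R a) \<bullet> c + F x \<bullet> c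
        = F (x + h *\<^sub>R a + h *\<^sub>R b) \<bullet> c - F (x + h *\<^sub>R a) \<bullet> c - F (x + h *\<^sub>R b) \<bullet> c + F x \<bullet> c" for h
      by (simp add: add.assoc add.commute[of "h *\<^sub>R b"])
    have 2: "((\<lambda>h. (F (x + h *\<^sub>R a + h *\<^sub>R b) \<bullet> c - F (x + h *\<^sub>R a) \<bullet> c - F (x + h *\<^sub>R b) \<bullet> c + F x \<bullet> c) / h\<^sup>2)
        \<longlongrightarrow> QP x \<bullet> c) (at_right 0)"
      unfolding swap[symmetric]
      by (rule second_difference_tendsto[where P = "\<lambda>x. Q x \<bullet> c" and R = "\<lambda>x. QP x \<bullet> c"])
        (intro inner Q QP continuous_intros assms)+
    show ?thesis by (rule tendsto_unique[OF _ 1 2]) simp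
  qed
  then show ?thesis using vector_eq_rdot by blast
qed

section \<open>Vanishing integrals of line derivatives of compactly supported functions\<close>

lemma has_line_derivative_zero_outside:
  assumes "closed K" "x \<notin> K" "\<And>y. y \<notin> K \<Longrightarrow> F y = 0"
  shows "has_line_derivative F 0 x a"
proof (rule has_vector_derivative_transform_within_open[where f = "\<lambda>_. 0"])
  show "open ((\<lambda>t. x + t *\<^sub>R a) -` (- K))"
    using assms(1) by (intro open_vimage continuous_intros) auto
qed (use assms in auto)

lemma line_derivative_zero_outside:
  assumes "closed K" "\<And>y. y \<notin> K \<Longrightarrow> F y = 0" "has_line_derivative F D x a" "x \<notin> K"
  shows "D = 0"
  using assms(3) has_line_derivative_zero_outside[OF assms(1,4,2)]
  by (rule vector_derivative_unique_at)

lemma integrable_continuous_zero_outside: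
  fixes h :: "'a::euclidean_space \<Rightarrow> 'b::{banach, second_countable_topology}"
  assumes "compact K" "continuous_on UNIV h" "\<And>x. x \<notin> K \<Longrightarrow> h x = 0"
  shows "integrable lborel h"
proof -
  have "integrable lborel (\<lambda>x. indicator K x *\<^sub>R h x)"
    using assms by (intro borel_integrable_compact) (auto intro: continuous_on_subset)
  also have "(\<lambda>x. indicator K x *\<^sub>R h x) = h"
    using assms(3) by (auto simp: indicator_def)
  finally show ?thesis .
qed

lemma integral_line_derivative_zero:
  fixes g :: "'a::euclidean_space \<Rightarrow> real"
  assumes K: "compact K" and g0: "\<And>x. x \<notin> K \<Longrightarrow> g x = 0"
    and g: "continuous_on UNIV g"
    and D: "\<And>x. has_line_derivative g (D x) x a" and D_cont: "continuous_on UNIV D"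
  shows "has_bochner_integral lborel D 0"
proof -
  have D0: "D x = 0" if "x \<notin> K" for x
    by (rule line_derivative_zero_outside[OF compact_imp_closed[OF K] g0 D that])
  have D_int: "integrable lborel D"
    by (rule integrable_continuous_zero_outside[OF K D_cont D0])
  have g_int: "integrable lborel g"
    by (rule integrable_continuous_zero_outside[OF K g g0])
  have "compact (D ` K)" using K D_cont by (auto intro: compact_continuous_image continuous_on_subset)
  then obtain C where "\<forall>y\<in>D ` K. norm y \<le> C"
    by (meson bounded_iff compact_imp_bounded)
  \<comment> \<open>The maximum with 0 covers points outside \<open>K\<close>, and also an empty
    \<open>K\<close>, for which \<open>C\<close> could be negative.\<close>
  then have B: "\<bar>D x\<bar> \<le> max C 0" for x
    using D0[of x] by (cases "x \<in> K") (auto simp: le_max_iff_disj)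
  define B where "B = max C 0"
  \<comment> \<open>\<open>K'\<close> is swept out by moving \<open>K\<close> along -a. As the steps
    1/(n+1) are at most 1, all difference quotients \<open>q n\<close> vanish outside this one
    compact set.\<close>
  define K' where "K' = {x + y | x y. x \<in> K \<and> y \<in> closed_segment 0 (-a)}"
  have K': "compact K'"
    unfolding K'_def by (intro compact_sums K compact_segment)
  define q where "q n x = (g (x + (1 / real (Suc n)) *\<^sub>R a) - g x) * real (Suc n)" for n x
  have lim: "(\<lambda>n. q n x) \<longlonglongrightarrow> D x" for x
  proof -
    have "((\<lambda>t. (g (x + t *\<^sub>R a) - g x) / t) \<longlongrightarrow> D x) (at 0)"
      using D[of x] by (simp add: DERIV_def flip: has_real_derivative_iff_has_vector_derivative)
    moreover have "filterlim (\<lambda>n. 1 / real (Suc n)) (at 0) sequentially"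
      unfolding filterlim_at using LIMSEQ_inverse_real_of_nat by (auto simp: inverse_eq_divide)
    ultimately have "(\<lambda>n. (g (x + (1 / real (Suc n)) *\<^sub>R a) - g x) / (1 / real (Suc n))) \<longlonglongrightarrow> D x"
      by (rule filterlim_compose)
    then show ?thesis by (simp add: q_def)
  qed
  \<comment> \<open>On \<open>K'\<close> the quotient is a value of \<open>D\<close> at an
    intermediate point; off \<open>K'\<close> both values of \<open>g\<close> in it are
    zero.\<close>
  have bound: "norm (q n x) \<le> B * indicator K' x" for n x
  proof (cases "x \<in> K'")
    case True
    obtain s where "g (x + (1 / real (Suc n)) *\<^sub>R a) - g x = 1 / real (Suc n) * D (x + s *\<^sub>R a)"
      using line_mean_value[where F = g and D = D and a = a and x = x and h = "1 / real (Suc n)"] D by auto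
    then have "q n x = D (x + s *\<^sub>R a)" by (simp add: q_def)
    with B True show ?thesis by (simp add: B_def)
  next
    case False
    have "x \<notin> K"
    proof
      assume "x \<in> K"
      then have "x + 0 \<in> K'" unfolding K'_def by blast
      with False show False by simp
    qed
    moreover have "x + (1 / real (Suc n)) *\<^sub>R a \<notin> K"
    proof
      assume *: "x + (1 / real (Suc n)) *\<^sub>R a \<in> K"
      have "(1 / real (Suc n)) *\<^sub>R (- a) \<in> closed_segment 0 (-a)"
        unfolding in_segment by (rule exI[of _ "1 / real (Suc n)"]) (auto simp: field_simps)
      with * have "(x + (1 / real (Suc n)) *\<^sub>R a) + (1 / real (Suc n)) *\<^sub>R (- a) \<in> K'"
        unfolding K'_def by blast
      with False show False by simp
    qed
    ultimately show ?thesis using g0 False by (simp add: q_def)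
  qed
  have shift: "integrable lborel (\<lambda>x. g (x + c))" "(\<integral>x. g (x + c) \<partial>lborel) = (\<integral>x. g x \<partial>lborel)" for c
  proof -
    have m: "g \<in> borel_measurable borel" using g by (rule borel_measurable_continuous_onI)
    have "integrable (distr lborel borel ((+) c)) g" using g_int by (simp add: lborel_distr_plus)
    then show "integrable lborel (\<lambda>x. g (x + c))"
      using m by (subst (asm) integrable_distr_eq) (auto simp: add.commute)
    have "(\<integral>x. g x \<partial>lborel) = (\<integral>x. g x \<partial>distr lborel borel ((+) c))" by (simp add: lborel_distr_plus)
    also have "\<dots> = (\<integral>x. g (x + c) \<partial>lborel)" using m by (subst integral_distr) (auto simp: add.commute)
    finally show "(\<integral>x. g (x + c) \<partial>lborel) = (\<integral>x. g x \<partial>lborel)" by simp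
  qed
  have q0: "integral\<^sup>L lborel (q n) = 0" for n
    unfolding q_def using shift g_int by simp
  have "(\<lambda>n. integral\<^sup>L lborel (q n)) \<longlonglongrightarrow> integral\<^sup>L lborel D"
  proof (rule integral_dominated_convergence[where w = "\<lambda>x. B * indicator K' x"])
    show "integrable lborel (\<lambda>x. B * indicator K' x)"
      using K'
      by (intro integrable_mult_right integrable_real_indicator emeasure_bounded_finite compact_imp_bounded)
        (auto intro: borel_compact)
    show "q n \<in> borel_measurable lborel" for n
      using shift g_int unfolding q_def by (intro borel_measurable_times borel_measurable_diff) auto
  qed (use D_int lim bound in auto)
  then have "integral\<^sup>L lborel D = 0"
    by (simp add: q0 LIMSEQ_const_iff)
  with D_int show ?thesis by (simp add: has_bochner_integral_iff)
qed

section \<open>Powers of the norm as weights and the weighted divergence theorem\<close>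

text \<open>The weight may be singular at the origin, but there the product vanishes on a whole
  neighbourhood. The open sets - {0} and - K cover the space, and the product is continuous on
  each.\<close>

lemma continuous_on_powr_weight:
  fixes h :: "'a::real_normed_vector \<Rightarrow> real"
  assumes K: "closed K" "0 \<notin> K" and h0: "\<And>x. x \<notin> K \<Longrightarrow> h x = 0" and h: "continuous_on UNIV h"
  shows "continuous_on UNIV (\<lambda>x. norm x powr c * h x)"
proof -
  have "continuous_on (- {0}) (\<lambda>x. norm x powr c * h x)"
    by (intro continuous_intros continuous_on_subset[OF h]) auto
  moreover have "continuous_on (- K) (\<lambda>x. norm x powr c * h x)"
    by (subst continuous_on_cong[where g = "\<lambda>_. 0"]) (auto simp: h0)
  ultimately have "continuous_on (- {0} \<union> - K) (\<lambda>x. norm x powr c * h x)"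
    using K by (intro continuous_on_open_Un) auto
  also have "- {0} \<union> - K = UNIV" using K by auto
  finally show ?thesis .
qed

lemma has_line_derivative_norm_powr:
  fixes x :: "'a::real_inner"
  assumes "x \<noteq> 0"
  shows "has_line_derivative (\<lambda>x. norm x powr c) (c * norm x powr (c - 2) * (x \<bullet> a)) x a"
proof -
  have "((\<lambda>t. norm (x + t *\<^sub>R a)) has_derivative (\<lambda>t. t * (x \<bullet> a) / norm x)) (at 0)"
  proof (rule has_derivative_eq_rhs[OF has_derivative_compose[where g = norm]])
    show "((\<lambda>t. x + t *\<^sub>R a) has_derivative (\<lambda>t. t *\<^sub>R a)) (at 0)"
      by (auto intro!: derivative_eq_intros)
    show "(norm has_derivative (\<lambda>y. y \<bullet> sgn x)) (at (x + 0 *\<^sub>R a))"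
      using has_derivative_norm[OF assms] by simp
  qed (auto simp: sgn_div_norm inner_commute field_simps)
  then have "((\<lambda>t. norm (x + t *\<^sub>R a)) has_real_derivative (x \<bullet> a) / norm x) (at 0)"
    unfolding has_field_derivative_def by (rule has_derivative_eq_rhs) auto
  then have "((\<lambda>t. norm (x + t *\<^sub>R a) powr c) has_real_derivative
      c * norm (x + 0 *\<^sub>R a) powr (c - of_nat 1) * ((x \<bullet> a) / norm x)) (at 0)"
    using assms by (intro DERIV_fun_powr) auto
  moreover have "norm x powr (c - 1) * ((x \<bullet> a) / norm x) = norm x powr (c - 2) * (x \<bullet> a)"
    using assms powr_diff[of "norm x" "c - 1" 1] by simp
  ultimately show ?thesis
    by (simp add: has_real_derivative_iff_has_vector_derivative mult.assoc del: times_divide_eq_right)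
qed

text \<open>The product rule for |x|^c g. At the origin, where the weight need not be
  differentiable, the product is locally zero because \<open>K\<close> is closed and omits 0, and
  the claimed derivative is zero there as well.\<close>

lemma integral_weighted_line_derivative:
  fixes g :: "'a::euclidean_space \<Rightarrow> real"
  assumes K: "compact K" "0 \<notin> K" and g0: "\<And>x. x \<notin> K \<Longrightarrow> g x = 0"
    and g: "continuous_on UNIV g"
    and D: "\<And>x. has_line_derivative g (D x) x a" and D_cont: "continuous_on UNIV D"
  shows "has_bochner_integral lborel
           (\<lambda>x. norm x powr c * D x + c * (norm x powr (c - 2) * ((x \<bullet> a) * g x))) 0"
proof (rule integral_line_derivative_zero[OF K(1)])
  note closed = compact_imp_closed[OF K(1)]
  have D0: "D x = 0" if "x \<notin> K" for x
    by (rule line_derivative_zero_outside[OF closed g0 D that])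
  show "continuous_on UNIV (\<lambda>x. norm x powr c * g x)"
    by (rule continuous_on_powr_weight[OF closed K(2) g0 g])
  show "continuous_on UNIV (\<lambda>x. norm x powr c * D x + c * (norm x powr (c - 2) * ((x \<bullet> a) * g x)))"
  proof (intro continuous_on_add continuous_on_mult_left)
    show "continuous_on UNIV (\<lambda>x. norm x powr c * D x)"
      by (rule continuous_on_powr_weight[OF closed K(2) D0 D_cont])
    show "continuous_on UNIV (\<lambda>x. norm x powr (c - 2) * ((x \<bullet> a) * g x))"
      by (rule continuous_on_powr_weight[OF closed K(2)]) (auto simp: g0 intro!: continuous_intros g)
  qed
  show "has_line_derivative (\<lambda>x. norm x powr c * g x)
      (norm x powr c * D x + c * (norm x powr (c - 2) * ((x \<bullet> a) * g x))) x a" for x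
  proof (cases "x = 0")
    case True
    then have "x \<notin> K" using K by simp
    then have "has_line_derivative (\<lambda>x. norm x powr c * g x) 0 x a"
      by (intro has_line_derivative_zero_outside[OF closed]) (auto simp: g0)
    with \<open>x \<notin> K\<close> show ?thesis by (simp add: g0[of x] D0[of x])
  next
    case False
    show ?thesis
      by (rule has_vector_derivative_eq_rhs
          [OF has_vector_derivative_mult[OF has_line_derivative_norm_powr[OF False] D]]) simp
  qed
qed (simp add: g0)

lemma has_line_derivative_inner:
  fixes F G :: "'a::real_normed_vector \<Rightarrow> 'b::real_inner"
  assumes "has_line_derivative F F' x a" "has_line_derivative G G' x a"
  shows "has_line_derivative (\<lambda>y. F y \<bullet> G y) (F x \<bullet> G' + F' \<bullet> G x) x a"
  using bounded_bilinear.has_vector_derivative[OF bounded_bilinear_inner assms] by simp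

lemma has_line_derivative_scaleR:
  fixes F :: "'a::real_normed_vector \<Rightarrow> real" and G :: "'a \<Rightarrow> 'b::real_normed_vector"
  assumes "has_line_derivative F F' x a" "has_line_derivative G G' x a"
  shows "has_line_derivative (\<lambda>y. F y *\<^sub>R G y) (F x *\<^sub>R G' + F' *\<^sub>R G x) x a"
  using bounded_bilinear.has_vector_derivative[OF bounded_bilinear_scaleR assms] by simp

lemma has_line_derivative_component:
  "has_line_derivative (\<lambda>x :: real ^ 'n. x $ j) (a $ j) x a"
  by (auto intro!: derivative_eq_intros simp: has_vector_derivative_def)

text \<open>The second summand pairs the gradient c |x|^(c-2) x of the weight with the field
  \<open>g\<close>. Each of the three integral identities for the cross terms comes from one choice
  of \<open>g\<close>.\<close>

lemma integral_weighted_divergence: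
  fixes g :: "'n::finite \<Rightarrow> real ^ 'n \<Rightarrow> real"
  assumes K: "compact K" "0 \<notin> K" and g0: "\<And>i x. x \<notin> K \<Longrightarrow> g i x = 0"
    and D: "\<And>i x. has_line_derivative (g i) (D i x) x (axis i 1)"
    and cont: "\<And>i. continuous_on UNIV (g i)" "\<And>i. continuous_on UNIV (D i)"
  shows "has_bochner_integral lborel
           (\<lambda>x. norm x powr c * (\<Sum>i\<in>UNIV. D i x)
              + c * (norm x powr (c - 2) * (\<Sum>i\<in>UNIV. x $ i * g i x))) 0"
proof -
  have "has_bochner_integral lborel
      (\<lambda>x. norm x powr c * D i x + c * (norm x powr (c - 2) * ((x \<bullet> axis i 1) * g i x))) 0" for i
    by (intro integral_weighted_line_derivative[OF K] g0 D cont)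
  then have "has_bochner_integral lborel
      (\<lambda>x. \<Sum>i\<in>UNIV. norm x powr c * D i x + c * (norm x powr (c - 2) * ((x \<bullet> axis i 1) * g i x)))
      (\<Sum>i\<in>(UNIV::'n set). 0)"
    by (rule has_bochner_integral_sum)
  then show ?thesis
    by (simp add: sum.distrib sum_distrib_left inner_axis)
qed

text \<open>At the origin both sides are 0, since \<open>0 powr c = 0\<close> for every real
  \<open>c\<close>.\<close>

lemma norm_powr_mult_norm_square:
  "norm x powr c * (norm x)\<^sup>2 = norm x powr (c + 2)"
  by (cases "x = 0") (simp_all add: powr_add powr_numeral)

section \<open>Twice continuously differentiable functions with compact support off the
  origin\<close>

text \<open>\<open>p\<close> and \<open>q\<close> are the first and second partial derivatives,
  \<open>q i j\<close> being the derivative of \<open>p i\<close> in direction j. Values lie in a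
  real inner product space; for complex values the inner product of z and w is the real part of
  conj(z) w.\<close>

locale C2_compactly_supported_off_origin =
  fixes f :: "real ^ 'n::finite \<Rightarrow> 'b::real_inner" and K :: "(real ^ 'n) set"
    and p :: "'n \<Rightarrow> real ^ 'n \<Rightarrow> 'b" and q :: "'n \<Rightarrow> 'n \<Rightarrow> real ^ 'n \<Rightarrow> 'b"
  assumes compact: "compact K" and origin: "0 \<notin> K" and f_zero: "x \<notin> K \<Longrightarrow> f x = 0"
    and f_deriv: "has_line_derivative f (p i x) x (axis i 1)"
    and p_deriv: "has_line_derivative (p i) (q i j x) x (axis j 1)"
    and f_cont: "continuous_on UNIV f" and p_cont: "continuous_on UNIV (p i)"
    and q_cont: "continuous_on UNIV (q i j)"
begin

lemma p_zero: "x \<notin> K \<Longrightarrow> p i x = 0"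
  by (rule line_derivative_zero_outside[OF compact_imp_closed[OF compact] f_zero f_deriv])

lemma q_zero: "x \<notin> K \<Longrightarrow> q i j x = 0"
  by (rule line_derivative_zero_outside[OF compact_imp_closed[OF compact] p_zero p_deriv])

lemma q_commute: "q i j x = q j i x"
  by (rule line_derivatives_commute[OF f_deriv p_deriv f_deriv p_deriv q_cont q_cont])

text \<open>The Euler operator x . grad f, which is |x| times the radial derivative away from the
  origin.\<close>

definition radial :: "real ^ 'n \<Rightarrow> 'b" where
  "radial x = (\<Sum>j\<in>UNIV. (x $ j) *\<^sub>R p j x)"

definition lap :: "real ^ 'n \<Rightarrow> 'b" where
  "lap x = (\<Sum>i\<in>UNIV. q i i x)"

definition grad_sq :: "real ^ 'n \<Rightarrow> real" where
  "grad_sq x = (\<Sum>i\<in>UNIV. p i x \<bullet> p i x)"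

lemma radial_zero: "x \<notin> K \<Longrightarrow> radial x = 0"
  and lap_zero: "x \<notin> K \<Longrightarrow> lap x = 0"
  and grad_sq_zero: "x \<notin> K \<Longrightarrow> grad_sq x = 0"
  by (simp_all add: radial_def lap_def grad_sq_def p_zero q_zero)

lemma radial_cont: "continuous_on UNIV radial"
  unfolding radial_def[abs_def] by (intro continuous_intros p_cont)

lemma lap_cont: "continuous_on UNIV lap"
  unfolding lap_def[abs_def] by (intro continuous_intros q_cont)

lemma grad_sq_cont: "continuous_on UNIV grad_sq"
  unfolding grad_sq_def[abs_def] by (intro continuous_intros p_cont)

lemmas zeros = f_zero p_zero q_zero radial_zero lap_zero grad_sq_zero
lemmas conts = f_cont p_cont q_cont radial_cont lap_cont grad_sq_cont

lemma radial_deriv: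
  "has_line_derivative radial (p i x + (\<Sum>j\<in>UNIV. (x $ j) *\<^sub>R q j i x)) x (axis i 1)"
proof -
  have "has_line_derivative radial
      (\<Sum>j\<in>UNIV. (x $ j) *\<^sub>R q j i x + (axis i 1 $ j) *\<^sub>R p j x) x (axis i 1)"
    unfolding radial_def
    by (intro has_vector_derivative_sum has_line_derivative_scaleR has_line_derivative_component p_deriv)
  moreover have "(\<Sum>j\<in>UNIV. (axis i 1 $ j) *\<^sub>R p j x) = p i x"
    by (simp add: axis_def if_distrib[of "\<lambda>c. c *\<^sub>R _"] cong: if_cong)
  ultimately show ?thesis by (simp add: sum.distrib add.commute)
qed

lemma weighted_integrable:
  assumes "continuous_on UNIV h" "\<And>x. x \<notin> K \<Longrightarrow> h x = 0"
  shows "integrable lborel (\<lambda>x. norm x powr c * h x)"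
  using assms
  by (intro integrable_continuous_zero_outside[OF compact] continuous_on_powr_weight[of K])
    (auto simp: compact_imp_closed compact origin)

text \<open>As simplification rules these discharge the integrability conditions that arise when the
  integral of a sum is split into the separate integrals.\<close>

lemma weighted_integrables [simp]:
  "integrable lborel (\<lambda>x. norm x powr c * (f x \<bullet> f x))"
  "integrable lborel (\<lambda>x. norm x powr c * (f x \<bullet> radial x))"
  "integrable lborel (\<lambda>x. norm x powr c * (radial x \<bullet> radial x))"
  "integrable lborel (\<lambda>x. norm x powr c * (f x \<bullet> lap x))"
  "integrable lborel (\<lambda>x. norm x powr c * (lap x \<bullet> radial x))"
  "integrable lborel (\<lambda>x. norm x powr c * (lap x \<bullet> lap x))"
  "integrable lborel (\<lambda>x. norm x powr c * grad_sq x)"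
  by (rule weighted_integrable; (intro continuous_intros conts)?; simp add: zeros)+

lemma norm_square_eq_sum: "(\<Sum>i\<in>UNIV. x $ i * x $ i) = (norm (x :: real ^ 'n))\<^sup>2"
  by (simp add: power2_norm_eq_inner inner_vec_def)

lemma norm_powr_mult_sum_square:
  "norm (x :: real ^ 'n) powr c * ((\<Sum>i\<in>UNIV. x $ i * x $ i) * y) = norm x powr (c + 2) * y"
  unfolding norm_square_eq_sum mult.assoc[symmetric] norm_powr_mult_norm_square ..

section \<open>Integral identities for the three cross terms\<close>

text \<open>The field x |f|^2 has divergence 2 f . (x . grad f) + n |f|^2. The gradient of the
  weight adds c |x|^(c-2) |x|^2 |f|^2, which is c |x|^c |f|^2; this explains the factor n +
  c.\<close>

lemma integral_f_radial:
  "2 * (\<integral>x. norm x powr c * (f x \<bullet> radial x) \<partial>lborel)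
     = - (real CARD('n) + c) * (\<integral>x. norm x powr c * (f x \<bullet> f x) \<partial>lborel)"
proof -
  let ?D = "\<lambda>i x. x $ i * (2 * (f x \<bullet> p i x)) + f x \<bullet> f x"
  have deriv: "has_line_derivative (\<lambda>x. x $ i *\<^sub>R (f x \<bullet> f x)) (?D i x) x (axis i 1)" for i x
    by (rule has_vector_derivative_eq_rhs[OF has_line_derivative_scaleR
          [OF has_line_derivative_component has_line_derivative_inner[OF f_deriv f_deriv]]])
      (simp add: inner_commute)
  have "has_bochner_integral lborel
      (\<lambda>x. norm x powr c * (\<Sum>i\<in>UNIV. ?D i x)
         + c * (norm x powr (c - 2) * (\<Sum>i\<in>UNIV. x $ i * (x $ i *\<^sub>R (f x \<bullet> f x))))) 0"
    by (intro integral_weighted_divergence[OF compact origin _ deriv] continuous_intros conts)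
      (simp add: zeros)
  moreover have "(\<Sum>i\<in>UNIV. ?D i x) = 2 * (f x \<bullet> radial x) + real CARD('n) * (f x \<bullet> f x)" for x
    by (simp add: radial_def sum.distrib inner_sum_right sum_distrib_left algebra_simps)
  moreover have "(\<Sum>i\<in>UNIV. x $ i * (x $ i *\<^sub>R (f x \<bullet> f x)))
      = (\<Sum>i\<in>UNIV. x $ i * x $ i) * (f x \<bullet> f x)" for x
    by (simp add: sum_distrib_right mult.assoc)
  ultimately have "has_bochner_integral lborel
      (\<lambda>x. norm x powr c * (2 * (f x \<bullet> radial x) + real CARD('n) * (f x \<bullet> f x))
         + c * (norm x powr c * (f x \<bullet> f x))) 0"
    by (simp add: norm_powr_mult_sum_square)
  then have "(\<integral>x. 2 * (norm x powr c * (f x \<bullet> radial x))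
      + (real CARD('n) + c) * (norm x powr c * (f x \<bullet> f x)) \<partial>lborel) = 0"
    by (simp add: has_bochner_integral_iff algebra_simps)
  then show ?thesis by (simp add: eq_neg_iff_add_eq_0 del: minus_add_distrib)
qed

text \<open>Green's first identity, from the field with components f . p_i; the last term is the
  contribution of the gradient of the weight.\<close>

lemma integral_f_lap:
  "(\<integral>x. norm x powr c * (f x \<bullet> lap x) \<partial>lborel)
     = - (\<integral>x. norm x powr c * grad_sq x \<partial>lborel)
       - c * (\<integral>x. norm x powr (c - 2) * (f x \<bullet> radial x) \<partial>lborel)"
proof -
  have deriv: "has_line_derivative (\<lambda>x. f x \<bullet> p i x) (f x \<bullet> q i i x + p i x \<bullet> p i x) x (axis i 1)" for i x
    by (rule has_line_derivative_inner[OF f_deriv p_deriv])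
  have "has_bochner_integral lborel
      (\<lambda>x. norm x powr c * (\<Sum>i\<in>UNIV. f x \<bullet> q i i x + p i x \<bullet> p i x)
         + c * (norm x powr (c - 2) * (\<Sum>i\<in>UNIV. x $ i * (f x \<bullet> p i x)))) 0"
    by (intro integral_weighted_divergence[OF compact origin _ deriv] continuous_intros conts)
      (simp add: zeros)
  moreover have "(\<Sum>i\<in>UNIV. f x \<bullet> q i i x + p i x \<bullet> p i x) = f x \<bullet> lap x + grad_sq x" for x
    by (simp add: lap_def grad_sq_def sum.distrib inner_sum_right)
  moreover have "(\<Sum>i\<in>UNIV. x $ i * (f x \<bullet> p i x)) = f x \<bullet> radial x" for x
    by (simp add: radial_def inner_sum_right)
  ultimately have "(\<integral>x. norm x powr c * (f x \<bullet> lap x) + norm x powr c * grad_sq x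
      + c * (norm x powr (c - 2) * (f x \<bullet> radial x)) \<partial>lborel) = 0"
    by (simp add: has_bochner_integral_iff distrib_left)
  then show ?thesis by simp
qed

text \<open>The Rellich--Pohozaev identity: the Hessian terms arising from the fields
  \<open>p\<^sub>i \<bullet> radial\<close> and \<open>x\<^sub>i grad_sq / 2\<close> cancel.\<close>

lemma integral_lap_radial:
  "2 * (\<integral>x. norm x powr c * (lap x \<bullet> radial x) \<partial>lborel)
     = (real CARD('n) + c - 2) * (\<integral>x. norm x powr c * grad_sq x \<partial>lborel)
       - 2 * c * (\<integral>x. norm x powr (c - 2) * (radial x \<bullet> radial x) \<partial>lborel)"
proof -
  \<comment> \<open>Twice the difference of the two fields, so that no halves occur.\<close>
  let ?g = "\<lambda>i x. 2 * (p i x \<bullet> radial x) - x $ i *\<^sub>R grad_sq x"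
  let ?D = "\<lambda>i x. 2 * (p i x \<bullet> (p i x + (\<Sum>j\<in>UNIV. (x $ j) *\<^sub>R q j i x)) + q i i x \<bullet> radial x)
      - (x $ i * (\<Sum>j\<in>UNIV. 2 * (p j x \<bullet> q j i x)) + grad_sq x)"
  have "has_line_derivative grad_sq (\<Sum>j\<in>UNIV. p j x \<bullet> q j i x + q j i x \<bullet> p j x) x (axis i 1)" for i x
    unfolding grad_sq_def by (intro has_vector_derivative_sum has_line_derivative_inner p_deriv)
  then have grad_sq_deriv:
    "has_line_derivative grad_sq (\<Sum>j\<in>UNIV. 2 * (p j x \<bullet> q j i x)) x (axis i 1)" for i x
    by (simp add: inner_commute)
  have deriv: "has_line_derivative (?g i) (?D i x) x (axis i 1)" for i x
    by (rule has_vector_derivative_eq_rhs[OF has_vector_derivative_diff[OF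
          has_vector_derivative_mult_right[OF has_line_derivative_inner[OF p_deriv radial_deriv]]
          has_line_derivative_scaleR[OF has_line_derivative_component grad_sq_deriv]]])
      simp
  have "has_bochner_integral lborel
      (\<lambda>x. norm x powr c * (\<Sum>i\<in>UNIV. ?D i x)
         + c * (norm x powr (c - 2) * (\<Sum>i\<in>UNIV. x $ i * ?g i x))) 0"
    by (intro integral_weighted_divergence[OF compact origin _ deriv] continuous_intros conts)
      (simp add: zeros)
  \<comment> \<open>The 2 comes from the summand \<open>p i x\<close> in the derivative of
    \<open>radial\<close>, and the dimension from the divergence n of the identity field x.\<close>
  moreover have "(\<Sum>i\<in>UNIV. ?D i x) = 2 * (lap x \<bullet> radial x) + (2 - real CARD('n)) * grad_sq x" for x
  proof -
    \<comment> \<open>Exchanging the sums and using the symmetry of \<open>q\<close> turns the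
      Hessian term of the first field into that of the second.\<close>
    have "(\<Sum>i\<in>UNIV. p i x \<bullet> (\<Sum>j\<in>UNIV. (x $ j) *\<^sub>R q j i x))
        = (\<Sum>i\<in>UNIV. \<Sum>j\<in>UNIV. x $ j * (p i x \<bullet> q j i x))"
      by (simp add: inner_sum_right)
    also have "\<dots> = (\<Sum>j\<in>UNIV. \<Sum>i\<in>UNIV. x $ j * (p i x \<bullet> q i j x))"
      by (subst sum.swap) (simp add: q_commute)
    finally have hessian: "(\<Sum>i\<in>UNIV. p i x \<bullet> (\<Sum>j\<in>UNIV. (x $ j) *\<^sub>R q j i x))
        = (\<Sum>i\<in>UNIV. x $ i * (\<Sum>j\<in>UNIV. p j x \<bullet> q j i x))"
      by (simp add: sum_distrib_left)
    have "(\<Sum>i\<in>UNIV. ?D i x)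
        = 2 * (grad_sq x + (\<Sum>i\<in>UNIV. p i x \<bullet> (\<Sum>j\<in>UNIV. (x $ j) *\<^sub>R q j i x)) + lap x \<bullet> radial x)
          - (2 * (\<Sum>i\<in>UNIV. x $ i * (\<Sum>j\<in>UNIV. p j x \<bullet> q j i x)) + real CARD('n) * grad_sq x)"
      unfolding sum_subtractf sum.distrib inner_add_right lap_def inner_sum_left
      by (simp add: grad_sq_def sum_distrib_left[symmetric] sum.distrib)
        (simp add: sum_distrib_left mult.left_commute)
    then show ?thesis unfolding hessian by (simp add: algebra_simps)
  qed
  moreover have "(\<Sum>i\<in>UNIV. x $ i * ?g i x)
      = 2 * (radial x \<bullet> radial x) - (\<Sum>i\<in>UNIV. x $ i * x $ i) * grad_sq x" for x
  proof -
    have "(\<Sum>i\<in>UNIV. x $ i * (p i x \<bullet> radial x)) = radial x \<bullet> radial x"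
      by (simp add: radial_def[of x] inner_sum_left)
    then show ?thesis
      by (simp add: right_diff_distrib sum_subtractf sum_distrib_right sum_distrib_left[symmetric]
          mult.left_commute[of _ 2] mult.assoc)
  qed
  ultimately have "has_bochner_integral lborel
      (\<lambda>x. norm x powr c * (2 * (lap x \<bullet> radial x) + (2 - real CARD('n)) * grad_sq x)
         + c * (2 * (norm x powr (c - 2) * (radial x \<bullet> radial x)) - norm x powr c * grad_sq x)) 0"
    by (simp add: right_diff_distrib norm_powr_mult_sum_square mult.left_commute[of _ 2])
  then have "(\<integral>x. 2 * (norm x powr c * (lap x \<bullet> radial x))
      - (real CARD('n) + c - 2) * (norm x powr c * grad_sq x)
      + 2 * c * (norm x powr (c - 2) * (radial x \<bullet> radial x)) \<partial>lborel) = 0"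
    by (simp add: has_bochner_integral_iff algebra_simps)
  then show ?thesis by simp
qed

section \<open>Pointwise estimates and the weighted Rellich inequality\<close>

text \<open>Cauchy--Schwarz for a sum of scalars times vectors: the triangle inequality passes to
  the numbers |x_i| and |p_i|, to which the L2 inequality applies.\<close>

lemma radial_square_le: "radial x \<bullet> radial x \<le> (norm x)\<^sup>2 * grad_sq x"
proof -
  have "norm (radial x) \<le> (\<Sum>i\<in>UNIV. \<bar>x $ i\<bar> * \<bar>norm (p i x)\<bar>)"
    unfolding radial_def by (rule order_trans[OF norm_sum]) simp
  also have "\<dots> \<le> norm x * sqrt (grad_sq x)"
  proof -
    have "norm x = L2_set (\<lambda>i. x $ i) UNIV" by (simp add: norm_vec_def L2_set_def)
    moreover have "sqrt (grad_sq x) = L2_set (\<lambda>i. norm (p i x)) UNIV"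
      by (simp add: L2_set_def grad_sq_def power2_norm_eq_inner)
    ultimately show ?thesis by (simp only: L2_set_mult_ineq)
  qed
  finally have "(norm (radial x))\<^sup>2 \<le> (norm x * sqrt (grad_sq x))\<^sup>2"
    by (rule power_mono) simp
  moreover have "grad_sq x \<ge> 0" unfolding grad_sq_def by (intro sum_nonneg) simp
  ultimately show ?thesis by (simp add: power_mult_distrib power2_norm_eq_inner)
qed

lemma integral_radial_le:
  "(\<integral>x. norm x powr (c - 2) * (radial x \<bullet> radial x) \<partial>lborel)
     \<le> (\<integral>x. norm x powr c * grad_sq x \<partial>lborel)"
proof (rule integral_mono)
  fix x
  have "norm x powr (c - 2) * (radial x \<bullet> radial x) \<le> norm x powr (c - 2) * ((norm x)\<^sup>2 * grad_sq x)"
    by (intro mult_left_mono radial_square_le) simp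
  also have "\<dots> = norm x powr c * grad_sq x"
    unfolding mult.assoc[symmetric] norm_powr_mult_norm_square by simp
  finally show "norm x powr (c - 2) * (radial x \<bullet> radial x) \<le> norm x powr c * grad_sq x" .
qed simp_all

text \<open>The right-hand side is the expansion of |x|^c |lap - \<alpha> |x|^(-2) radial - \<beta>
  |x|^(-2) f|^2 for x away from 0. At the origin every term vanishes because the weights do.\<close>

lemma weighted_square_nonneg:
  "0 \<le> norm x powr c * (lap x \<bullet> lap x)
     - 2 * \<alpha> * (norm x powr (c - 2) * (lap x \<bullet> radial x))
     - 2 * \<beta> * (norm x powr (c - 2) * (f x \<bullet> lap x))
     + \<alpha>\<^sup>2 * (norm x powr (c - 4) * (radial x \<bullet> radial x))
     + 2 * \<alpha> * \<beta> * (norm x powr (c - 4) * (f x \<bullet> radial x))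
     + \<beta>\<^sup>2 * (norm x powr (c - 4) * (f x \<bullet> f x))" (is "0 \<le> ?rhs")
proof (cases "x = 0")
  case False
  define s where "s = (norm x)\<^sup>2"
  define w where "w = norm x powr (c - 4)"
  have 2: "norm x powr (c - 2) = w * s"
    using norm_powr_mult_norm_square[of x "c - 4"] by (simp add: s_def w_def)
  have 4: "norm x powr c = w * s * s"
    using norm_powr_mult_norm_square[of x "c - 2"] by (simp add: s_def 2)
  \<comment> \<open>Multiplying the vector inside the square by |x|^2 clears the negative powers, at
    the price of the weight |x|^(c-4).\<close>
  let ?T = "s *\<^sub>R lap x - \<alpha> *\<^sub>R radial x - \<beta> *\<^sub>R f x"
  have "0 \<le> w * (?T \<bullet> ?T)" by (simp add: w_def)
  also have "\<dots> = ?rhs"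
    unfolding 2 4 w_def[symmetric]
    by (simp add: inner_diff_left inner_diff_right inner_commute[of "lap x" "f x"]
        inner_commute[of "radial x" "f x"]
        inner_commute[of "radial x" "lap x"] algebra_simps power2_eq_square)
  finally show ?thesis .
qed simp

theorem weighted_rellich:
  "(\<alpha> * (\<gamma> + real CARD('n) - 4) - 2 * \<beta>) * (\<integral>x. norm x powr (\<gamma> - 2) * grad_sq x \<partial>lborel)
     - \<alpha> * (\<alpha> - 4 + 2 * \<gamma>) * (\<integral>x. norm x powr (\<gamma> - 4) * (radial x \<bullet> radial x) \<partial>lborel)
     + \<beta> * ((real CARD('n) - 4) * (\<alpha> - 2) - \<beta> + \<gamma> * (real CARD('n) + \<alpha> + \<gamma> - 6))
         * (\<integral>x. norm x powr (\<gamma> - 4) * (f x \<bullet> f x) \<partial>lborel)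
   \<le> (\<integral>x. norm x powr \<gamma> * (lap x \<bullet> lap x) \<partial>lborel)"
proof -
  define LL where "LL = (\<integral>x. norm x powr \<gamma> * (lap x \<bullet> lap x) \<partial>lborel)"
  define LR where "LR = (\<integral>x. norm x powr (\<gamma> - 2) * (lap x \<bullet> radial x) \<partial>lborel)"
  define FL where "FL = (\<integral>x. norm x powr (\<gamma> - 2) * (f x \<bullet> lap x) \<partial>lborel)"
  define RR where "RR = (\<integral>x. norm x powr (\<gamma> - 4) * (radial x \<bullet> radial x) \<partial>lborel)"
  define FR where "FR = (\<integral>x. norm x powr (\<gamma> - 4) * (f x \<bullet> radial x) \<partial>lborel)"
  define FF where "FF = (\<integral>x. norm x powr (\<gamma> - 4) * (f x \<bullet> f x) \<partial>lborel)"
  define G where "G = (\<integral>x. norm x powr (\<gamma> - 2) * grad_sq x \<partial>lborel)"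
  let ?n = "real CARD('n)"
  have "0 \<le> (\<integral>x. norm x powr \<gamma> * (lap x \<bullet> lap x)
     - 2 * \<alpha> * (norm x powr (\<gamma> - 2) * (lap x \<bullet> radial x))
     - 2 * \<beta> * (norm x powr (\<gamma> - 2) * (f x \<bullet> lap x))
     + \<alpha>\<^sup>2 * (norm x powr (\<gamma> - 4) * (radial x \<bullet> radial x))
     + 2 * \<alpha> * \<beta> * (norm x powr (\<gamma> - 4) * (f x \<bullet> radial x))
     + \<beta>\<^sup>2 * (norm x powr (\<gamma> - 4) * (f x \<bullet> f x)) \<partial>lborel)"
    by (intro Bochner_Integration.integral_nonneg weighted_square_nonneg)
  also have "\<dots> = LL - 2 * \<alpha> * LR - 2 * \<beta> * FL + \<alpha>\<^sup>2 * RR + 2 * \<alpha> * \<beta> * FR + \<beta>\<^sup>2 * FF"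
    by (simp add: LL_def LR_def FL_def RR_def FR_def FF_def)
  \<comment> \<open>The doubled integrals are isolated because the identities for \<open>LR\<close>
    and \<open>FR\<close> determine exactly these.\<close>
  also have "\<dots> = LL - \<alpha> * (2 * LR) - 2 * \<beta> * FL + \<alpha>\<^sup>2 * RR + \<alpha> * \<beta> * (2 * FR) + \<beta>\<^sup>2 * FF"
    by simp
  finally have square: "0 \<le> LL - \<alpha> * (2 * LR) - 2 * \<beta> * FL + \<alpha>\<^sup>2 * RR + \<alpha> * \<beta> * (2 * FR) + \<beta>\<^sup>2 * FF" .
  have FR: "2 * FR = - (?n + \<gamma> - 4) * FF"
    using integral_f_radial[of "\<gamma> - 4"] unfolding FR_def FF_def by (simp add: add_diff_eq)
  have FL0: "FL = - G - (\<gamma> - 2) * FR"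
    using integral_f_lap[of "\<gamma> - 2"] unfolding FL_def G_def FR_def by simp
  have FL: "2 * \<beta> * FL = - 2 * \<beta> * G - \<beta> * (\<gamma> - 2) * (2 * FR)"
    unfolding FL0 by (simp add: algebra_simps)
  have LR: "2 * LR = (?n + \<gamma> - 4) * G - 2 * (\<gamma> - 2) * RR"
    using integral_lap_radial[of "\<gamma> - 2"] unfolding LR_def G_def RR_def by simp
  \<comment> \<open>The coefficient of \<open>RR\<close> is \<alpha>^2 + 2 \<alpha> (\<gamma> - 2) =
    \<alpha> (\<alpha> - 4 + 2 \<gamma>). The direct term and the one produced by \<open>FL\<close>
    give \<open>FR\<close> the total factor 2 \<beta> (\<alpha> + \<gamma> - 2), so the bracket with
    \<open>FF\<close> is (\<alpha> + \<gamma> - 2)(n + \<gamma> - 4) - \<beta>, which expands to the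
    stated one.\<close>
  show ?thesis
    using square unfolding FL LR FR
    unfolding LL_def[symmetric] RR_def[symmetric] FF_def[symmetric] G_def[symmetric]
    by (simp add: algebra_simps power2_eq_square)
qed

end

section \<open>Specialization to smooth complex-valued functions\<close>

text \<open>\<open>partial_deriv\<close> is defined through \<open>vector_derivative\<close>, which
  is meaningful only where a derivative exists; total differentiability and the chain rule along x +
  t e_i show that it is a genuine line derivative.\<close>

lemma C0_infinity_imp_C2_compactly_supported_off_origin:
  assumes "f \<in> C0_infinity (UNIV - {0})"
  shows "C2_compactly_supported_off_origin f (supp f)
           (\<lambda>i. partial_deriv i f) (\<lambda>i j. partial_deriv j (partial_deriv i f))"
proof -
  have C: "C_k 2 f" "compact (supp f)" "0 \<notin> supp f"
    using assms by (auto simp: C0_infinity_def C_infinity_def)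
  have deriv: "has_line_derivative g (partial_deriv i g x) x (axis i 1)"
    if "g differentiable_on UNIV" for g :: "real ^ 'a \<Rightarrow> complex" and i x
  proof -
    have "g differentiable at (x + 0 *\<^sub>R axis i 1)"
      using that by (simp add: differentiable_on_def)
    then have "(g \<circ> (\<lambda>t. x + t *\<^sub>R axis i 1)) differentiable at 0"
      by (intro differentiable_chain_at derivative_intros) auto
    then show ?thesis
      unfolding partial_deriv_def by (simp add: o_def flip: vector_derivative_works)
  qed
  show ?thesis
  proof
    show "f x = 0" if "x \<notin> supp f" for x
      using that closure_subset[of "{x. f x \<noteq> 0}"] unfolding supp_def by blast
  qed (use C in \<open>auto simp: numeral_2_eq_2 intro: deriv differentiable_imp_continuous_on\<close>)
qed

theorem theorem2p1:
  fixes \<alpha> \<beta> \<gamma> :: real and f :: "real ^ 'n::finite \<Rightarrow> complex"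
  assumes "CARD('n) \<ge> 2"
    and "f \<in> C0_infinity (UNIV - {0})"
  shows
    "(\<integral>x. norm x powr \<gamma> * (norm (laplacian f x))\<^sup>2 \<partial>lborel)
       \<ge> (\<alpha> * (\<gamma> + real CARD('n) - 4) - 2 * \<beta>)
            * (\<integral>x. norm x powr (\<gamma> - 2) * (norm (grad f x))\<^sup>2 \<partial>lborel)
         - \<alpha> * (\<alpha> - 4 + 2 * \<gamma>)
            * (\<integral>x. norm x powr (\<gamma> - 4) * (norm (real_cdot x (grad f x)))\<^sup>2 \<partial>lborel)
         + \<beta> * ((real CARD('n) - 4) * (\<alpha> - 2) - \<beta> + \<gamma> * (real CARD('n) + \<alpha> + \<gamma> - 6))
            * (\<integral>x. norm x powr (\<gamma> - 4) * (norm (f x))\<^sup>2 \<partial>lborel)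
     \<and> (\<alpha> * (\<alpha> - 4 + 2 * \<gamma>) \<ge> 0 \<longrightarrow>
        (\<integral>x. norm x powr \<gamma> * (norm (laplacian f x))\<^sup>2 \<partial>lborel)
          \<ge> (\<alpha> * (real CARD('n) - \<alpha> - \<gamma>) - 2 * \<beta>)
               * (\<integral>x. norm x powr (\<gamma> - 2) * (norm (grad f x))\<^sup>2 \<partial>lborel)
            + \<beta> * ((real CARD('n) - 4) * (\<alpha> - 2) - \<beta> + \<gamma> * (real CARD('n) + \<alpha> + \<gamma> - 6))
               * (\<integral>x. norm x powr (\<gamma> - 4) * (norm (f x))\<^sup>2 \<partial>lborel))"
proof -
  interpret C2_compactly_supported_off_origin f "supp f"
    "\<lambda>i. partial_deriv i f" "\<lambda>i j. partial_deriv j (partial_deriv i f)"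
    using assms(2) by (rule C0_infinity_imp_C2_compactly_supported_off_origin)
  have lap: "laplacian f = lap"
    by (simp add: fun_eq_iff laplacian_def lap_def)
  have rad: "real_cdot x (grad f x) = radial x" for x
    by (simp add: real_cdot_def grad_def radial_def scaleR_conv_of_real)
  have grad: "(norm (grad f x))\<^sup>2 = grad_sq x" for x
    by (simp add: power2_norm_eq_inner inner_vec_def grad_def grad_sq_def)
  define G where "G = (\<integral>x. norm x powr (\<gamma> - 2) * grad_sq x \<partial>lborel)"
  define R where "R = (\<integral>x. norm x powr (\<gamma> - 4) * (radial x \<bullet> radial x) \<partial>lborel)"
  have "R \<le> G"
    using integral_radial_le[of "\<gamma> - 2"] by (simp add: R_def G_def)
  then have "\<alpha> * (\<alpha> - 4 + 2 * \<gamma>) * R \<le> \<alpha> * (\<alpha> - 4 + 2 * \<gamma>) * G" if "\<alpha> * (\<alpha> - 4 + 2 * \<gamma>) \<ge> 0"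
    using that by (rule mult_left_mono)
  \<comment> \<open>Replacing \<open>R\<close> by the larger \<open>G\<close> lowers the coefficient
    of \<open>G\<close> by \<alpha> (\<alpha> - 4 + 2 \<gamma>), and (\<gamma> + n - 4) - (\<alpha>
    - 4 + 2 \<gamma>) = n - \<alpha> - \<gamma>.\<close>
  moreover have "(\<alpha> * (real CARD('n) - \<alpha> - \<gamma>) - 2 * \<beta>) * G
      = (\<alpha> * (\<gamma> + real CARD('n) - 4) - 2 * \<beta>) * G - \<alpha> * (\<alpha> - 4 + 2 * \<gamma>) * G"
    by (simp add: algebra_simps)
  ultimately show ?thesis
    using weighted_rellich[of \<alpha> \<gamma> \<beta>]
    unfolding lap rad grad unfolding power2_norm_eq_inner G_def[symmetric] R_def[symmetric]
    by linarith
qed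

end
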